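(* Let $k\in\mathbb{N}$ and let $\ell(\cdot)$ be a lazy deterministic tree traversal algorithm that is $c_k$-competitive on all layered tree instances of width at most $k$. Then there is a distributed asynchronous collective tree exploration (DACTE) algorithm (using $\ell(\cdot)$ as a subroutine) with $k$ robots that explores any tree with $n$ nodes and depth $D$ in at most $2n+k c_k D$ moves.
   Context: Nodes and layers. Let $\mathcal{V}=\bigcup_{d\ge 0}\mathbb{N}^d$ be the set of finite sequences of natural numbers (the empty sequence is the root $r$); $v$ is an ancestor of $u$ (written $v\succeq u$) if $v$ is a prefix of $u$; $d(u,v)$ is the usual tree distance $d(u)+d(v)-2d(A(u,v))$ where $d(\cdot)$ is length and $A(u,v)$ the longest common prefix. A layer is a finite set of pairwise incomparable nodes (an antichain for $\succeq$). For layers $\mathcal{L},\mathcal{L}'$, write $\mathcal{L}\succeq\mathcal{L}'$ if every node of $\mathcal{L}'$ has an ancestor in $\mathcal{L}$. The active tree of a layer is $\mathcal{T}(\mathcal{L})=\{u\in\mathcal{V}: u \text{ has a descendant in }\mathcal{L}\}$. A layered tree instance is a sequence $\mathcal{L}(1)\succeq\mathcal{L}(2)\succeq\cdots$ of layers; its underlying tree is $\bigcup_t\mathcal{T}(\mathcal{L}(t))$, its depth $D$ is the depth of the underlying tree, and its width is $\max_t|\mathcal{L}(t)|$. A deterministic tree traversal algorithm maps each partial input $(\mathcal{L}(1),\dots,\mathcal{L}(t))$ to a node $\ell(t)\in\mathcal{L}(t)$; its cost on the instance is $\sum_t d(\ell(t-1),\ell(t))$. It is $c_w$-competitive on width-$w$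 instances if its cost is at most $c_w D$ on every instance of width at most $w$ and depth $D$. It is lazy if $\ell(t)\in\mathcal{L}(t+1)$ implies $\ell(t+1)=\ell(t)$. DACTE model. An unknown finite rooted tree is explored by $k$ robots starting at the root. Every node carries an unbounded whiteboard; robots have unbounded memory and computation; all initially empty. At each round an omniscient adversary selects one robot, which (1) reads the whiteboard at its node, (2) observes the adjacent nodes, (3) writes on that whiteboard and updates its memory, (4) moves along an edge to a neighbour (no reading/writing at the destination). Each round is one move. A node is visited once a robot located there has been activated; exploration finishes when all nodes are visited. The algorithm explores in at most $M$ moves if, against every adversary, it finishes within $M$ rounds. *)

theory Defs
  imports Complex_Main "HOL-Library.Sublist"
begin

section \<open>Layered trees\<close>

text \<open>
  A node is a finite sequence of natural numbers, so that \<open>prefix v u\<close> says that \<open>v\<close> is an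
  ancestor of \<open>u\<close> (every node being an ancestor of itself).
\<close>

type_synonym node = "nat list"

definition tree_dist :: "node \<Rightarrow> node \<Rightarrow> nat" where
  "tree_dist u v = length u + length v - 2 * length (longest_common_prefix u v)"

definition is_layer :: "node set \<Rightarrow> bool" where
  "is_layer L \<longleftrightarrow> finite L \<and> pairwise (\<lambda>u v. u \<parallel> v) L"

definition layer_above :: "node set \<Rightarrow> node set \<Rightarrow> bool" where
  "layer_above L L' \<longleftrightarrow> (\<forall>u\<in>L'. \<exists>v\<in>L. prefix v u)"

definition active_tree :: "node set \<Rightarrow> node set" where
  "active_tree L = {u. \<exists>v\<in>L. prefix u v}"

text \<open>
  The list \<open>[L(1), \<dots>, L(t)]\<close> is both a partial input and a finite instance; an infinite instance
  is determined by its finite initial segments, and a linear bound on the cost holds for all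
  instances as soon as it holds for the finite ones. Layers are nonempty because an algorithm has
  to choose a node in each of them.
\<close>

definition layered_instance :: "node set list \<Rightarrow> bool" where
  "layered_instance Ls \<longleftrightarrow>
     Ls \<noteq> [] \<and> (\<forall>L\<in>set Ls. is_layer L \<and> L \<noteq> {}) \<and> successively layer_above Ls"

definition underlying_tree :: "node set list \<Rightarrow> node set" where
  "underlying_tree Ls = (\<Union>L\<in>set Ls. active_tree L)"

definition tree_depth :: "node set \<Rightarrow> nat" where
  "tree_depth T = Max (length ` T)"

definition instance_width :: "node set list \<Rightarrow> nat" where
  "instance_width Ls = Max (card ` set Ls)"

definition traversal_algorithm :: "(node set list \<Rightarrow> node) \<Rightarrow> bool" where
  "traversal_algorithm l \<longleftrightarrow> (\<forall>Ls. layered_instance Ls \<longrightarrow> l Ls \<in> last Ls)"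

text \<open>The traversal starts at the root: \<open>traverser l Ls 0\<close> is the node \<open>l(0) = r\<close>.\<close>

definition traverser :: "(node set list \<Rightarrow> node) \<Rightarrow> node set list \<Rightarrow> nat \<Rightarrow> node" where
  "traverser l Ls t = (if t = 0 then [] else l (take t Ls))"

definition traversal_cost :: "(node set list \<Rightarrow> node) \<Rightarrow> node set list \<Rightarrow> nat" where
  "traversal_cost l Ls =
     (\<Sum>t = 1..length Ls. tree_dist (traverser l Ls (t - 1)) (traverser l Ls t))"

definition competitive :: "(node set list \<Rightarrow> node) \<Rightarrow> nat \<Rightarrow> real \<Rightarrow> bool" where
  "competitive l w c \<longleftrightarrow>
     (\<forall>Ls. layered_instance Ls \<and> instance_width Ls \<le> w \<longrightarrow>
        real (traversal_cost l Ls) \<le> c * real (tree_depth (underlying_tree Ls)))"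

definition lazy_traversal :: "(node set list \<Rightarrow> node) \<Rightarrow> bool" where
  "lazy_traversal l \<longleftrightarrow>
     (\<forall>Ls L. layered_instance Ls \<and> layered_instance (Ls @ [L]) \<and> l Ls \<in> L \<longrightarrow>
        l (Ls @ [L]) = l Ls)"


section \<open>Distributed asynchronous collective tree exploration\<close>

text \<open>
  Up to renaming of nodes, every finite rooted tree is a finite prefix-closed set of nodes with
  root \<open>[]\<close>. The labels of the children of a node are arbitrary distinct natural numbers.
\<close>

definition rooted_tree :: "node set \<Rightarrow> bool" where
  "rooted_tree T \<longleftrightarrow> finite T \<and> [] \<in> T \<and> (\<forall>u\<in>T. \<forall>v. prefix v u \<longrightarrow> v \<in> T)"

text \<open>
  A robot observes the nodes adjacent to its position, but not their names as sequences: it only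
  sees the edge labels by which they can be told apart.
\<close>

datatype port = Parent | Child nat

definition ports :: "node set \<Rightarrow> node \<Rightarrow> port set" where
  "ports T u = (if u = [] then {} else {Parent}) \<union> Child ` {i. u @ [i] \<in> T}"

fun neighbour :: "node \<Rightarrow> port \<Rightarrow> node" where
  "neighbour u Parent = butlast u"
| "neighbour u (Child i) = u @ [i]"

text \<open>
  Whiteboards and memories hold arbitrary finite words, which encode arbitrary finite data; the
  empty word is the initial content.

  An algorithm maps the content of the whiteboard at the current node, the memory of the robot and
  the set of observed ports to the new content of the whiteboard, the new memory and the port of
  the next move. It is an arbitrary function (computation is unbounded), and it is the same for all
  robots: they have no a priori identities.
\<close>

type_synonym word = "nat list"

type_synonym dacte = "word \<Rightarrow> word \<Rightarrow> port set \<Rightarrow> word \<times> word \<times> port"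

definition dacte_algorithm :: "dacte \<Rightarrow> bool" where
  "dacte_algorithm A \<longleftrightarrow>
     (\<forall>b m P b' m' p. finite P \<and> P \<noteq> {} \<and> A b m P = (b', m', p) \<longrightarrow> p \<in> P)"

record config =
  position :: "nat \<Rightarrow> node"
  memory :: "nat \<Rightarrow> word"
  whiteboard :: "node \<Rightarrow> word"
  visited :: "node set"

definition initial_config :: config where
  "initial_config =
     \<lparr>position = (\<lambda>_. []), memory = (\<lambda>_. []), whiteboard = (\<lambda>_. []), visited = {}\<rparr>"

text \<open>
  One round, in which robot \<open>i\<close> is selected. The robot has no neighbour to move to only if the tree
  is a single node; it then stays where it is.
\<close>

definition activate :: "dacte \<Rightarrow> node set \<Rightarrow> nat \<Rightarrow> config \<Rightarrow> config" where
  "activate A T i C =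
     (let u = position C i;
          P = ports T u;
          (b, m, p) = A (whiteboard C u) (memory C i) P
      in \<lparr>position = (position C)(i := if P = {} then u else neighbour u p),
          memory = (memory C)(i := m),
          whiteboard = (whiteboard C)(u := b),
          visited = insert u (visited C)\<rparr>)"

primrec run :: "dacte \<Rightarrow> node set \<Rightarrow> (nat \<Rightarrow> nat) \<Rightarrow> nat \<Rightarrow> config" where
  "run A T s 0 = initial_config"
| "run A T s (Suc t) = activate A T (s t) (run A T s t)"

text \<open>
  The robots are numbered \<open>0, \<dots>, k - 1\<close>. As the algorithm is deterministic, an omniscient adversary
  is an arbitrary sequence of robots \<open>s\<close>, which may depend on the algorithm and on the tree.
\<close>

definition explores_within :: "dacte \<Rightarrow> nat \<Rightarrow> node set \<Rightarrow> real \<Rightarrow> bool" where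
  "explores_within A k T M \<longleftrightarrow>
     (\<forall>s. (\<forall>t. s t < k) \<longrightarrow> (\<exists>t. real t \<le> M \<and> visited (run A T s t) = T))"

end

theory Submission
  imports Defs "HOL-Library.Countable"
begin

text \<open>
  Robots share all they know through the whiteboards. Each robot has an anchor, to which it walks
  and below which it explores depth first: it takes edges that nobody has taken yet, and goes back
  up when there are none. When the anchor itself has no such edge left, the robot
  appends to its own layered tree instance the layer of the topmost nodes that it does not know
  to be exhausted, and its next anchor is the node chosen by the traversal algorithm.
  A robot never leaves the subtree of a node before the node is exhausted, so each node of such a
  layer contains a robot in the past that is known to the owner of the layer; hence the width is at
  most \<open>k\<close>. Every edge is taken at most once for exploration and once on the way back, and the walks
  of a robot between anchors cost at most \<open>c D\<close>.
\<close>

section \<open>Distances in the tree\<close>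

lemma longest_common_prefix_snoc:
  "longest_common_prefix (v @ [c]) a =
     (if prefix (v @ [c]) a then v @ [c] else longest_common_prefix v a)"
proof (induction v arbitrary: a)
  case Nil
  then show ?case by (cases a) auto
next
  case (Cons x v)
  then show ?case by (cases a) auto
qed

lemma longest_common_prefix_of_prefix: "prefix v a \<Longrightarrow> longest_common_prefix v a = v"
proof (induction v arbitrary: a)
  case (Cons x v)
  then show ?case by (cases a) auto
qed simp

lemma tree_dist_snoc_prefix:
  assumes "prefix (v @ [c]) a"
  shows "tree_dist v a = Suc (tree_dist (v @ [c]) a)"
proof -
  have "prefix v a"
    using assms by (auto intro: append_prefixD)
  then show ?thesis
    using assms prefix_length_le[OF assms]
    by (simp add: tree_dist_def longest_common_prefix_of_prefix)
qed

lemma tree_dist_snoc_not_prefix: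
  assumes "\<not> prefix (v @ [c]) a"
  shows "tree_dist (v @ [c]) a = Suc (tree_dist v a)"
proof -
  have "length (longest_common_prefix v a) \<le> length v"
       "length (longest_common_prefix v a) \<le> length a"
    by (simp_all add: prefix_length_le longest_common_prefix_prefix1 longest_common_prefix_prefix2)
  then show ?thesis
    using assms by (simp add: tree_dist_def longest_common_prefix_snoc)
qed

lemma tree_dist_self [simp]: "tree_dist a a = 0"
  by (simp add: tree_dist_def longest_common_prefix_of_prefix)

text \<open>The first edge of the tree path from \<open>u\<close> to \<open>a\<close>; without
  meaning for \<open>u = a\<close>.\<close>

definition toward :: "node \<Rightarrow> node \<Rightarrow> port" where
  "toward u a = (if prefix u a then Child (a ! length u) else Parent)"

lemma toward_port:
  assumes "rooted_tree T" "u \<in> T" "a \<in> T" "u \<noteq> a"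
  shows "toward u a \<in> ports T u"
    and "tree_dist u a = Suc (tree_dist (neighbour u (toward u a)) a)"
proof -
  have "toward u a \<in> ports T u \<and> tree_dist u a = Suc (tree_dist (neighbour u (toward u a)) a)"
  proof (cases "prefix u a")
    case True
    then obtain b r where "a = u @ b # r"
      using \<open>u \<noteq> a\<close> by (metis append_Nil2 neq_Nil_conv prefixE)
    then have b: "a ! length u = b" and p: "prefix (u @ [b]) a" by auto
    have "u @ [b] \<in> T"
      using p assms unfolding rooted_tree_def by blast
    then show ?thesis
      using True b tree_dist_snoc_prefix[OF p] by (simp add: toward_def ports_def)
  next
    case False
    then obtain v c where "u = v @ [c]" by (metis Nil_prefix rev_exhaust)
    then show ?thesis
      using False tree_dist_snoc_not_prefix by (auto simp: toward_def ports_def)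
  qed
  then show "toward u a \<in> ports T u"
    and "tree_dist u a = Suc (tree_dist (neighbour u (toward u a)) a)" by auto
qed

lemma neighbour_in_tree:
  assumes "rooted_tree T" "u \<in> T" "p \<in> ports T u"
  shows "neighbour u p \<in> T"
  using assms unfolding rooted_tree_def ports_def
  by (auto split: if_splits simp: prefixeq_butlast)


section \<open>Knowledge about exhausted nodes\<close>

text \<open>
  A node is exhausted once all edges to its children have been traversed. Knowledge is the list
  of the nodes that are known to be exhausted, each with the labels of its children.
\<close>

type_synonym knowledge = "(node \<times> nat list) list"

definition exhausted :: "knowledge \<Rightarrow> node set" where
  "exhausted K = fst ` set K"

text \<open>The topmost nodes not known to be exhausted. Candidates come only from the root and the
  recorded child labels, so a robot can compute the layer without knowing the tree.\<close>

definition layer :: "knowledge \<Rightarrow> node set" where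
  "layer K = {x \<in> insert [] (\<Union>(y, cs)\<in>set K. (\<lambda>c. y @ [c]) ` set cs).
     x \<notin> exhausted K \<and> (\<forall>y. strict_prefix y x \<longrightarrow> y \<in> exhausted K)}"

definition sound :: "node set \<Rightarrow> node set \<Rightarrow> knowledge \<Rightarrow> bool" where
  "sound T W K \<longleftrightarrow> (\<forall>(x, cs)\<in>set K. x \<in> T \<and> x \<in> W \<and> set cs = {c. x @ [c] \<in> T})"

lemma exhausted_simps [simp]:
  "exhausted [] = {}"
  "exhausted (e # K) = insert (fst e) (exhausted K)"
  "exhausted (K @ K') = exhausted K \<union> exhausted K'"
  by (auto simp: exhausted_def)

lemma exhausted_mono: "set K \<subseteq> set K' \<Longrightarrow> exhausted K \<subseteq> exhausted K'"
  by (auto simp: exhausted_def)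

lemma sound_simps [simp]:
  "sound T W []"
  "sound T W ((x, cs) # K) \<longleftrightarrow> x \<in> T \<and> x \<in> W \<and> set cs = {c. x @ [c] \<in> T} \<and> sound T W K"
  "sound T W (K @ K') \<longleftrightarrow> sound T W K \<and> sound T W K'"
  by (auto simp: sound_def)

lemma sound_mono: "sound T W K \<Longrightarrow> W \<subseteq> W' \<Longrightarrow> sound T W' K"
  by (auto simp: sound_def)

lemma exhausted_visited: "sound T W K \<Longrightarrow> exhausted K \<subseteq> W"
  by (auto simp: sound_def exhausted_def)

lemma is_layer_layer: "is_layer (layer K)"
proof -
  have "x \<parallel> y" if "x \<in> layer K" "y \<in> layer K" "x \<noteq> y" for x y
    using that unfolding layer_def parallel_def strict_prefix_def by blast
  moreover have "finite (layer K)"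
    unfolding layer_def by (rule finite_Collect_conjI) (auto intro!: finite_UN_I)
  ultimately show ?thesis
    by (simp add: is_layer_def pairwise_def)
qed

lemma layer_subset: "sound T W K \<Longrightarrow> [] \<in> T \<Longrightarrow> layer K \<subseteq> T"
  by (auto simp: layer_def sound_def)

lemma layer_covers:
  assumes "rooted_tree T" "sound T W K" "x \<in> T" "x \<notin> exhausted K"
  shows "\<exists>v\<in>layer K. prefix v x"
  using assms(3,4)
proof (induction "length x" arbitrary: x rule: less_induct)
  case less
  show ?case
  proof (cases "\<forall>y. strict_prefix y x \<longrightarrow> y \<in> exhausted K")
    case True
    \<comment> \<open>The parent of a non-root \<open>x\<close> is exhausted, and by soundness its
      entry lists all its children, so \<open>x\<close> is a candidate.\<close>
    have "x \<in> insert [] (\<Union>(y, cs)\<in>set K. (\<lambda>c. y @ [c]) ` set cs)"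
    proof (cases x rule: rev_exhaust)
      case (snoc y c)
      then have "y \<in> exhausted K" using True by (simp add: strict_prefix_def)
      then obtain cs where "(y, cs) \<in> set K" by (auto simp: exhausted_def)
      moreover have "c \<in> set cs"
        using calculation assms(2) less.prems snoc by (auto simp: sound_def)
      ultimately show ?thesis using snoc by auto
    qed simp
    then have "x \<in> layer K"
      using True less.prems by (simp add: layer_def)
    then show ?thesis by blast
  next
    case False
    then obtain y where y: "strict_prefix y x" "y \<notin> exhausted K" by blast
    then have "y \<in> T" "length y < length x"
      using assms(1) less.prems unfolding rooted_tree_def
      by (auto intro: prefix_length_less dest: prefix_order.less_imp_le)
    then obtain v where "v \<in> layer K" "prefix v y" using less.hyps y by blast
    then show ?thesis using y by (meson prefix_order.trans prefix_order.less_imp_le)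
  qed
qed

text \<open>A node unexhausted in \<open>K'\<close> was unexhausted in the smaller \<open>K\<close>,
  so its topmost unexhausted ancestor there covers it.\<close>

lemma layer_above_layer:
  assumes "rooted_tree T" "sound T W K" "sound T W K'" "set K \<subseteq> set K'"
  shows "layer_above (layer K) (layer K')"
  unfolding layer_above_def
proof
  fix x assume x: "x \<in> layer K'"
  then have "x \<in> T"
    using layer_subset[OF assms(3)] assms(1) by (auto simp: rooted_tree_def)
  moreover have "x \<notin> exhausted K"
    using x exhausted_mono[OF assms(4)] by (auto simp: layer_def)
  ultimately show "\<exists>v\<in>layer K. prefix v x"
    using layer_covers assms by blast
qed


section \<open>The algorithm\<close>

text \<open>
  The memory of a robot holds its position, its anchor, its knowledge, and the knowledge it had
  at each of its former changes of anchor; the latter determines the layered tree instance given to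
  the traversal algorithm. The whiteboard holds knowledge and the labels of the children that have
  been entered for exploration.
\<close>

type_synonym robot = "node \<times> node \<times> knowledge \<times> knowledge list"
type_synonym board = "knowledge \<times> nat list"

text \<open>The single letter keeps every encoded value apart from the empty word, which stands for
  the initial value.\<close>

definition encode :: "'a::countable \<Rightarrow> word" where
  "encode x = [to_nat x]"

definition decode :: "'a::countable \<Rightarrow> word \<Rightarrow> 'a" where
  "decode d w = (if w = [] then d else from_nat (hd w))"

lemma decode_simps [simp]: "decode d [] = d" "decode d (encode x) = x"
  by (simp_all add: decode_def encode_def)

definition step :: "(node set list \<Rightarrow> node) \<Rightarrow> board \<Rightarrow> robot \<Rightarrow> port set \<Rightarrow>
    knowledge \<times> nat list \<times> node \<times> knowledge list \<times> port" where
  "step l = (\<lambda>(Kb, X) (u, a, Km, Ks) P.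
     let K = Kb @ Km; C = {c. Child c \<in> P}; K' = (u, sorted_list_of_set C) # K in
     if \<not> prefix a u then (K, X, a, Ks, toward u a)
     else if C - set X \<noteq> {} then
       (let c = Min (C - set X) in (K, c # X, a, Ks, Child c))
     else if u \<noteq> a then (K', X, a, Ks, Parent)
     else
       (let a' = l (map layer (Ks @ [K'])) in (K', X, a', Ks @ [K'], toward u a')))"

definition start :: robot where
  "start = ([], [], [], [])"

text \<open>The default port only makes the algorithm legal on arbitrary contents; while exploration
  is unfinished, \<open>p\<close> is shown to be a port. The position is kept by dead
  reckoning.\<close>

definition explorer :: "(node set list \<Rightarrow> node) \<Rightarrow> dacte" where
  "explorer l b m P =
     (let r = decode start m;
          (K, X, a, Ks, p) = step l (decode ([], []) b) r P;
          p' = if p \<in> P then p else SOME q. q \<in> P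
      in (encode (K, X), encode (neighbour (fst r) p', a, K, Ks), p'))"

lemma dacte_algorithm_explorer: "dacte_algorithm (explorer l)"
  unfolding dacte_algorithm_def explorer_def
  by (auto simp: Let_def some_in_eq split: prod.splits if_splits)

text \<open>
  A robot on its way to its anchor already counts as being there, so that the subtrees it passes
  through are not credited with it.
\<close>

fun place :: "robot \<Rightarrow> node" where
  "place (u, a, _, _) = (if prefix a u then u else a)"

section \<open>Growing instances and counting edges\<close>

definition instance_ok :: "nat \<Rightarrow> node set \<Rightarrow> node set list \<Rightarrow> bool" where
  "instance_ok k T Ls \<longleftrightarrow> layered_instance Ls \<and> (\<forall>L\<in>set Ls. card L \<le> k \<and> L \<subseteq> T)"

text \<open>Earlier choices depend on earlier prefixes only; the \<open>if\<close> supplies the root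
  as starting node.\<close>

lemma traversal_cost_snoc:
  "traversal_cost l (Ls @ [L]) =
     traversal_cost l Ls + tree_dist (if Ls = [] then [] else l Ls) (l (Ls @ [L]))"
proof -
  have "traverser l (Ls @ [L]) t = traverser l Ls t" if "t \<le> length Ls" for t
    using that by (simp add: traverser_def)
  then have "(\<Sum>t = 1..length Ls. tree_dist (traverser l (Ls @ [L]) (t - 1)) (traverser l (Ls @ [L]) t))
      = traversal_cost l Ls"
    unfolding traversal_cost_def by (intro sum.cong) auto
  then show ?thesis
    by (simp add: traversal_cost_def traverser_def)
qed

lemma instance_ok_snoc:
  assumes "Ls = [] \<or> instance_ok k T Ls \<and> layer_above (last Ls) L"
    and "is_layer L" "L \<noteq> {}" "card L \<le> k" "L \<subseteq> T"
  shows "instance_ok k T (Ls @ [L])"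
  using assms by (auto simp: instance_ok_def layered_instance_def successively_append_iff)

lemma sum_change:
  fixes f g :: "'a \<Rightarrow> nat"
  assumes "finite A" "i \<in> A" "\<And>j. j \<in> A \<Longrightarrow> j \<noteq> i \<Longrightarrow> f j = g j"
  shows "sum f A + g i = sum g A + f i"
proof -
  have "sum f (A - {i}) = sum g (A - {i})"
    using assms(3) by (intro sum.cong) auto
  then show ?thesis
    using sum.remove[OF assms(1,2), of f] sum.remove[OF assms(1,2), of g] by simp
qed

lemma finite_children:
  assumes "rooted_tree T"
  shows "finite {c. u @ [c] \<in> T}"
  by (rule finite_imageD[of "\<lambda>c. u @ [c]"])
    (use assms in \<open>auto simp: rooted_tree_def intro: finite_subset[of _ T] inj_onI\<close>)

text \<open>Every node but the root is counted once, at its parent.\<close>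

lemma sum_children:
  assumes "rooted_tree T"
  shows "Suc (\<Sum>u\<in>T. card {c. u @ [c] \<in> T}) = card T"
proof -
  have fin: "finite T" and "[] \<in> T" and cl: "\<And>u v. u \<in> T \<Longrightarrow> prefix v u \<Longrightarrow> v \<in> T"
    using assms by (auto simp: rooted_tree_def)
  have "bij_betw (\<lambda>(u, c). u @ [c]) (SIGMA u:T. {c. u @ [c] \<in> T}) (T - {[]})"
  proof (rule bij_betwI')
    fix y assume "y \<in> T - {[]}"
    then show "\<exists>x\<in>SIGMA u:T. {c. u @ [c] \<in> T}. y = (\<lambda>(u, c). u @ [c]) x"
      using cl by (cases y rule: rev_exhaust) auto
  qed auto
  then have "card (T - {[]}) = card (SIGMA u:T. {c. u @ [c] \<in> T})"
    by (simp add: bij_betw_same_card)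
  also have "\<dots> = (\<Sum>u\<in>T. card {c. u @ [c] \<in> T})"
    using fin finite_children[OF assms] by (simp add: card_SigmaI)
  finally show ?thesis
    using fin \<open>[] \<in> T\<close> by (metis card_Suc_Diff1)
qed


section \<open>Invariants of a run\<close>

locale exploration =
  fixes l :: "node set list \<Rightarrow> node" and k :: nat and T :: "node set" and s :: "nat \<Rightarrow> nat"
  assumes traversal: "traversal_algorithm l"
    and tree: "rooted_tree T"
    and schedule: "s t < k"
begin

abbreviation conf :: "nat \<Rightarrow> config" where
  "conf t \<equiv> run (explorer l) T s t"

definition robot :: "nat \<Rightarrow> nat \<Rightarrow> robot" where
  "robot t i = decode start (memory (conf t) i)"

definition board :: "nat \<Rightarrow> node \<Rightarrow> board" where
  "board t u = decode ([], []) (whiteboard (conf t) u)"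

abbreviation visits :: "nat \<Rightarrow> node set" where
  "visits t \<equiv> visited (conf t)"

lemma evolve:
  assumes "robot t (s t) = (u, a, Km, Ks)" "board t u = (Kb, X)" "position (conf t) (s t) = u"
    and "step l (Kb, X) (u, a, Km, Ks) (ports T u) = (K', X', a', Ks', p)" "p \<in> ports T u"
  shows "robot (Suc t) = (robot t)(s t := (neighbour u p, a', K', Ks'))"
    and "board (Suc t) = (board t)(u := (K', X'))"
    and "position (conf (Suc t)) = (position (conf t))(s t := neighbour u p)"
    and "visits (Suc t) = insert u (visits t)"
  using assms by (auto simp: robot_def board_def activate_def explorer_def Let_def fun_eq_iff)

definition entered :: "(nat \<Rightarrow> nat) \<Rightarrow> node set" where
  "entered V = {x. \<exists>j<k. \<exists>\<tau>\<le>V j. prefix x (place (robot \<tau> j))}"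

text \<open>
  \<open>V\<close> is a vector clock: the owner of the knowledge \<open>K\<close> has heard of robot \<open>j\<close> up to time \<open>V j\<close>.
  A robot it has seen leaving a subtree has told it that the root of the subtree is exhausted.
\<close>

definition informed :: "nat \<Rightarrow> (nat \<Rightarrow> nat) \<Rightarrow> knowledge \<Rightarrow> bool" where
  "informed t V K \<longleftrightarrow> (\<forall>j. V j \<le> t) \<and>
     (\<forall>j<k. \<forall>\<tau>\<le>V j. \<forall>x. prefix x (place (robot \<tau> j)) \<longrightarrow>
        prefix x (place (robot (V j) j)) \<or> x \<in> exhausted K) \<and>
     (\<forall>x\<in>exhausted K. \<forall>c. x @ [c] \<in> T \<longrightarrow> x @ [c] \<in> entered V)"

text \<open>\<open>Ks = []\<close> with \<open>a = []\<close> matches the start of the traverser at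
  the root. The last entry of \<open>Ks\<close> is tracked because the next layer must lie below its
  layer. \<open>V i = t\<close> says that a robot is always up to date about itself.\<close>

definition robot_inv :: "nat \<Rightarrow> nat \<Rightarrow> bool" where
  "robot_inv t i \<longleftrightarrow> (case robot t i of (u, a, K, Ks) \<Rightarrow>
     u = position (conf t) i \<and> u \<in> T \<and> a \<in> T \<and>
     (\<forall>y. strict_prefix y a \<longrightarrow> y \<in> exhausted K) \<and> sound T (visits t) K \<and>
     (Ks = [] \<and> a = [] \<or>
        Ks \<noteq> [] \<and> instance_ok k T (map layer Ks) \<and> a = l (map layer Ks) \<and>
        sound T (visits t) (last Ks) \<and> set (last Ks) \<subseteq> set K) \<and>
     (\<exists>V. V i = t \<and> informed t V K))"

definition board_inv :: "nat \<Rightarrow> node \<Rightarrow> bool" where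
  "board_inv t u \<longleftrightarrow> (case board t u of (K, X) \<Rightarrow>
     sound T (visits t) K \<and> distinct X \<and> set X \<subseteq> {c. u @ [c] \<in> T} \<and>
     (\<exists>V. informed t V K \<and> (\<forall>c\<in>set X. u @ [c] \<in> entered V)))"

definition lag :: "robot \<Rightarrow> nat" where
  "lag = (\<lambda>(u, a, K, Ks). tree_dist u a)"

definition cost :: "robot \<Rightarrow> nat" where
  "cost = (\<lambda>(u, a, K, Ks). traversal_cost l (map layer Ks))"

definition count_inv :: "nat \<Rightarrow> bool" where
  "count_inv t \<longleftrightarrow> t + (\<Sum>i<k. lag (robot t i)) =
     2 * (\<Sum>u\<in>T. length (snd (board t u))) + (\<Sum>i<k. cost (robot t i))"

section \<open>Merging and advancing vector clocks\<close>

lemma entered_mono: "(\<And>j. V j \<le> V' j) \<Longrightarrow> entered V \<subseteq> entered V'"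
  unfolding entered_def by (blast intro: le_trans)

text \<open>For each robot, the knowledge that belongs to the later clock entry already lists the
  subtrees which that robot has left.\<close>

lemma informed_merge:
  assumes "informed t V K" "informed t V' K'"
  shows "informed t (\<lambda>j. max (V j) (V' j)) (K @ K')"
proof -
  have "entered V \<subseteq> entered (\<lambda>j. max (V j) (V' j))"
       "entered V' \<subseteq> entered (\<lambda>j. max (V j) (V' j))"
    by (auto intro!: entered_mono)
  moreover have "prefix x (place (robot (max (V j) (V' j)) j)) \<or> x \<in> exhausted (K @ K')"
    if "j < k" "\<tau> \<le> max (V j) (V' j)" "prefix x (place (robot \<tau> j))" for j \<tau> x
  proof (cases "V j \<le> V' j")
    case True
    then have "\<tau> \<le> V' j" using that by simp
    then have "prefix x (place (robot (V' j) j)) \<or> x \<in> exhausted K'"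
      using assms(2) that unfolding informed_def by blast
    then show ?thesis using True by (auto simp: max_def)
  next
    case False
    then have "\<tau> \<le> V j" using that by simp
    then have "prefix x (place (robot (V j) j)) \<or> x \<in> exhausted K"
      using assms(1) that unfolding informed_def by blast
    then show ?thesis using False by (auto simp: max_def)
  qed
  ultimately show ?thesis
    using assms unfolding informed_def by auto
qed

lemma informed_extend:
  assumes "informed t V K" "exhausted K \<subseteq> exhausted K'"
    and "\<And>x c. x \<in> exhausted K' \<Longrightarrow> x @ [c] \<in> T \<Longrightarrow> x \<in> exhausted K \<or> x @ [c] \<in> entered V"
  shows "informed t V K'"
  using assms unfolding informed_def by blast

text \<open>The robot's own entry may advance if every subtree left in this round has an exhausted
  root. This serves the active robot and, with an unchanged place, the idle ones.\<close>

lemma informed_advance: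
  assumes "informed t V K" "V i = t"
    and "\<And>x. prefix x (place (robot t i)) \<Longrightarrow>
           prefix x (place (robot (Suc t) i)) \<or> x \<in> exhausted K"
  shows "informed (Suc t) (V(i := Suc t)) K"
proof -
  have "entered V \<subseteq> entered (V(i := Suc t))"
    using assms by (intro entered_mono) auto
  moreover have "prefix x (place (robot ((V(i := Suc t)) j) j)) \<or> x \<in> exhausted K"
    if "j < k" "\<tau> \<le> (V(i := Suc t)) j" "prefix x (place (robot \<tau> j))" for j \<tau> x
  proof (cases "j = i")
    case True
    show ?thesis
    proof (cases "\<tau> = Suc t")
      case False
      then have "\<tau> \<le> V i" "i < k" using that True assms(2) by auto
      then have "prefix x (place (robot t i)) \<or> x \<in> exhausted K"
        using that True assms(1,2) unfolding informed_def by blast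
      then show ?thesis using assms(3) True by auto
    qed (use that True in auto)
  qed (use that assms in \<open>auto simp: informed_def\<close>)
  ultimately show ?thesis
    using assms(1) unfolding informed_def by (auto simp: le_Suc_eq)
qed

lemma informed_later: "informed t V K \<Longrightarrow> informed (Suc t) V K"
  unfolding informed_def by (auto simp: le_Suc_eq)

text \<open>
  Every node of the layer contains the last known place of some robot, and the subtrees of
  incomparable nodes are disjoint.
\<close>

lemma card_layer_le:
  assumes "informed t V K" "sound T W K"
  shows "card (layer K) \<le> k"
proof -
  have "\<exists>j<k. prefix x (place (robot (V j) j))" if "x \<in> layer K" for x
  proof (cases x rule: rev_exhaust)
    case Nil
    \<comment> \<open>The root contains every robot, and \<open>schedule\<close> forces
      \<open>k\<close> to be positive.\<close>
    then show ?thesis using schedule by auto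
  next
    case (snoc y c)
    then have "y \<in> exhausted K" and "x \<notin> exhausted K"
      using that by (auto simp: layer_def strict_prefix_def)
    moreover have "x \<in> T"
      using layer_subset[OF assms(2)] tree that by (auto simp: rooted_tree_def)
    \<comment> \<open>The parent of \<open>x\<close> is exhausted, so some robot has entered
      \<open>x\<close>; had it been seen leaving, \<open>x\<close> would be known to be
      exhausted.\<close>
    ultimately have "x \<in> entered V"
      using assms(1) snoc by (auto simp: informed_def)
    then show ?thesis
      using assms(1) \<open>x \<notin> exhausted K\<close> unfolding informed_def entered_def by blast
  qed
  then obtain f where f: "\<And>x. x \<in> layer K \<Longrightarrow> f x < k \<and> prefix x (place (robot (V (f x)) (f x)))"
    by metis
  have "inj_on f (layer K)"
  proof (rule inj_onI, rule ccontr)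
    fix x y assume xy: "x \<in> layer K" "y \<in> layer K" "f x = f y" "x \<noteq> y"
    then have "x \<parallel> y"
      using is_layer_layer[of K] by (auto simp: is_layer_def pairwise_def)
    then show False
      using f[OF xy(1)] f[OF xy(2)] xy(3) by (metis prefix_same_cases parallelD1 parallelD2)
  qed
  then have "card (layer K) \<le> card {..<k}"
    using f by (intro card_inj_on_le) auto
  then show ?thesis by simp
qed

section \<open>Analysis of one round\<close>

text \<open>\<open>W\<close> is the visited set after the round; its being proper makes the next
  layer nonempty. The last conjunct is the local form of \<open>count_inv\<close>.\<close>

lemma step_facts:
  assumes rob: "robot t i = (u, a, Km, Ks)" "robot_inv t i"
    and brd: "board t u = (Kb, X)" "board_inv t u"
    and W: "W = insert u (visits t)" "W \<subset> T"
    and V: "informed t V (Kb @ Km)" "\<And>c. c \<in> set X \<Longrightarrow> u @ [c] \<in> entered V"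
    and st: "step l (Kb, X) (u, a, Km, Ks) (ports T u) = (K', X', a', Ks', p)"
  defines "u' \<equiv> neighbour u p"
  shows "p \<in> ports T u \<and> sound T W K' \<and> set Km \<subseteq> set K' \<and> informed t V K' \<and>
    a' \<in> T \<and> (\<forall>y. strict_prefix y a' \<longrightarrow> y \<in> exhausted K') \<and>
    (Ks' = [] \<and> a' = [] \<or>
       Ks' \<noteq> [] \<and> instance_ok k T (map layer Ks') \<and> a' = l (map layer Ks') \<and>
       sound T W (last Ks') \<and> set (last Ks') \<subseteq> set K') \<and>
    (\<forall>x. prefix x (place (u, a, Km, Ks)) \<longrightarrow>
       prefix x (place (u', a', K', Ks')) \<or> x \<in> exhausted K') \<and>
    (X' = X \<or> (\<exists>c. X' = c # X \<and> c \<notin> set X \<and> u @ [c] \<in> T \<and>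
       place (u', a', K', Ks') = u @ [c])) \<and>
    Suc (tree_dist u' a' + 2 * length X + traversal_cost l (map layer Ks)) =
      tree_dist u a + 2 * length X' + traversal_cost l (map layer Ks')"
proof -
  define K where "K = Kb @ Km"
  define C where "C = {c. Child c \<in> ports T u}"
  define Ke where "Ke = (u, sorted_list_of_set C) # K"
  have C: "C = {c. u @ [c] \<in> T}"
    by (auto simp: C_def ports_def)
  have root: "[] \<in> T"
    using tree by (auto simp: rooted_tree_def)
  have "finite C"
    unfolding C by (rule finite_children[OF tree])
  have u: "u \<in> T" and a: "a \<in> T" and anc: "\<And>y. strict_prefix y a \<Longrightarrow> y \<in> exhausted Km"
    and Km: "sound T W Km" and pc: "Ks = [] \<and> a = [] \<or>
        Ks \<noteq> [] \<and> instance_ok k T (map layer Ks) \<and> a = l (map layer Ks) \<and>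
        sound T W (last Ks) \<and> set (last Ks) \<subseteq> set Km"
    using rob W by (auto simp: robot_inv_def intro: sound_mono)
  have Kb: "sound T W Kb" and X: "distinct X" "set X \<subseteq> C"
    using brd W C by (auto simp: board_inv_def intro: sound_mono)
  have K: "sound T W K" using Km Kb by (simp add: K_def)
  have iK: "informed t V K" using V by (simp add: K_def)
  have Ke: "sound T W Ke"
    using K u W C \<open>finite C\<close> by (simp add: Ke_def)
  \<comment> \<open>All children of \<open>u\<close> are in \<open>X\<close> and hence entered
    within the clock, so \<open>u\<close> may be listed as exhausted.\<close>
  have iKe: "informed t V Ke" if "C \<subseteq> set X"
    using iK by (rule informed_extend) (use that V(2) C in \<open>auto simp: Ke_def\<close>)
  have step: "(K', X', a', Ks', p) =
     (if \<not> prefix a u then (K, X, a, Ks, toward u a)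
      else if C - set X \<noteq> {} then (K, Min (C - set X) # X, a, Ks, Child (Min (C - set X)))
      else if u \<noteq> a then (Ke, X, a, Ks, Parent)
      else (Ke, X, l (map layer (Ks @ [Ke])), Ks @ [Ke], toward u (l (map layer (Ks @ [Ke])))))"
    using st[symmetric] by (simp only: step_def Let_def prod.case K_def C_def Ke_def)
  consider (walk) "\<not> prefix a u" | (down) "prefix a u" "C - set X \<noteq> {}"
    | (up) "prefix a u" "C \<subseteq> set X" "u \<noteq> a" | (new) "C \<subseteq> set X" "u = a"
    by auto
  then show ?thesis
  proof cases
    case walk
    then have eq: "K' = K" "X' = X" "a' = a" "Ks' = Ks" "p = toward u a"
      using step by auto
    have "u \<noteq> a" using walk by auto
    note tow = toward_port[OF tree u a this]
    \<comment> \<open>A walking robot counts as being at \<open>a\<close>, and its next place has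
      \<open>a\<close> as an ancestor, so it leaves no subtree.\<close>
    show ?thesis
      unfolding u'_def eq using tow K iK a anc pc walk by (auto simp: K_def)
  next
    case down
    define c where "c = Min (C - set X)"
    have eq: "K' = K" "X' = c # X" "a' = a" "Ks' = Ks" "p = Child c"
      using step down by (auto simp: c_def)
    have c: "c \<in> C" "c \<notin> set X"
      using Min_in[of "C - set X"] down(2) \<open>finite C\<close> by (auto simp: c_def)
    have pa: "prefix a (u @ [c])" using down by simp
    then have "\<not> prefix (u @ [c]) a"
      using prefix_length_le[OF down(1)] by (auto dest!: prefix_length_le)
    note tree_dist_snoc_not_prefix[OF this]
    then show ?thesis
      unfolding u'_def eq using K iK a anc pc down(1) pa c C by (auto simp: K_def C_def)
  next
    case up
    then have eq: "K' = Ke" "X' = X" "a' = a" "Ks' = Ks" "p = Parent"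
      using step by auto
    obtain v c where uv: "u = v @ [c]"
      using up by (cases u rule: rev_exhaust) auto
    \<comment> \<open>The parent of \<open>u\<close> is still at or below \<open>a\<close>; the only
      subtree left is that of \<open>u\<close>, which \<open>Ke\<close> lists.\<close>
    then have av: "prefix a v"
      using up by auto
    then have "\<not> prefix (v @ [c]) a"
      by (auto dest!: prefix_length_le)
    note tree_dist_snoc_not_prefix[OF this]
    moreover have "p \<in> ports T u"
      using uv eq by (simp add: ports_def)
    ultimately show ?thesis
      unfolding u'_def eq using Ke iKe[OF up(2)] a anc pc up(1) av
      by (auto simp: K_def Ke_def uv)
  next
    case new
    let ?a = "l (map layer (Ks @ [Ke]))"
    have eq: "K' = Ke" "X' = X" "a' = ?a" "Ks' = Ks @ [Ke]" "p = toward u ?a"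
      using step new by auto
    \<comment> \<open>Exhausted nodes have been visited, and \<open>W\<close> is not all of
      \<open>T\<close>, so some node is unexhausted.\<close>
    have "exhausted Ke \<noteq> T" using exhausted_visited[OF Ke] W by auto
    moreover have "exhausted Ke \<subseteq> T" using exhausted_visited[OF Ke] W by auto
    ultimately obtain x where "x \<in> T" "x \<notin> exhausted Ke" by auto
    then have "layer Ke \<noteq> {}"
      using layer_covers[OF tree Ke] by blast
    moreover have "Ks = [] \<or>
        instance_ok k T (map layer Ks) \<and> layer_above (last (map layer Ks)) (layer Ke)"
    proof (cases "Ks = []")
      case False
      then have "layer_above (layer (last Ks)) (layer Ke)"
        using pc Ke by (intro layer_above_layer[OF tree]) (auto simp: Ke_def K_def)
      then show ?thesis using False pc by (simp add: last_map)
    qed simp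
    ultimately have inst: "instance_ok k T (map layer (Ks @ [Ke]))"
      using card_layer_le[OF iKe[OF new(1)] Ke] is_layer_layer layer_subset[OF Ke root]
        instance_ok_snoc[of "map layer Ks" k T "layer Ke"] by simp
    then have "?a \<in> last (map layer (Ks @ [Ke]))"
      using traversal unfolding traversal_algorithm_def instance_ok_def by blast
    then have "?a \<in> layer Ke" by simp
    then have aT: "?a \<in> T" and anc': "\<And>y. strict_prefix y ?a \<Longrightarrow> y \<in> exhausted Ke"
      and "?a \<notin> exhausted Ke"
      using layer_subset[OF Ke root] unfolding layer_def by blast+
    moreover have "u \<in> exhausted Ke" by (simp add: Ke_def)
    ultimately have ne: "u \<noteq> ?a" by metis
    note tow = toward_port[OF tree u aT ne]
    \<comment> \<open>The place may jump from \<open>a\<close> to the new anchor, so all ancestors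
      of \<open>a\<close> must be exhausted: \<open>a\<close> itself by this round, the strict ones
      by the invariant.\<close>
    have "y \<in> exhausted Ke" if "prefix y a" for y
    proof (cases "y = a")
      case False
      then have "y \<in> exhausted Km" using that by (intro anc) (simp add: strict_prefix_def)
      then show ?thesis by (simp add: Ke_def K_def)
    qed (simp add: Ke_def new(2))
    moreover have "traversal_cost l (map layer (Ks @ [Ke])) =
        traversal_cost l (map layer Ks) + tree_dist u ?a"
    proof -
      \<comment> \<open>The robot stands at the traverser's previous node, so the cost grows by
        exactly the coming walk.\<close>
      have "(if map layer Ks = [] then [] else l (map layer Ks)) = u"
        using pc new(2) by auto
      then show ?thesis
        using traversal_cost_snoc[of l "map layer Ks" "layer Ke"] by (simp del: if_split)
    qed
    moreover have "set Km \<subseteq> set Ke" by (auto simp: Ke_def K_def)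
    moreover have "place (u, a, Km, Ks) = a" using new(2) by simp
    ultimately show ?thesis
      unfolding u'_def eq using tow Ke iKe[OF new(1)] aT anc' inst new(2)
      by simp
  qed
qed

section \<open>Preservation of the invariants\<close>

lemma preserved:
  assumes "\<And>i. i < k \<Longrightarrow> robot_inv t i" "\<And>v. board_inv t v" "count_inv t"
    and vis: "visits t \<subseteq> T" "visits (Suc t) \<noteq> T"
  shows "(\<forall>i<k. robot_inv (Suc t) i) \<and> (\<forall>v. board_inv (Suc t) v) \<and> count_inv (Suc t) \<and>
    visits (Suc t) \<subseteq> T"
proof -
  define i where "i = s t"
  have i: "i < k" using schedule by (simp add: i_def)
  obtain u a Km Ks where rob: "robot t i = (u, a, Km, Ks)" by (metis prod_cases4)
  obtain Kb X where brd: "board t u = (Kb, X)" by (metis surj_pair)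
  obtain K' X' a' Ks' p where st: "step l (Kb, X) (u, a, Km, Ks) (ports T u) = (K', X', a', Ks', p)"
    by (metis prod_cases5)
  define u' where "u' = neighbour u p"
  have ri: "robot_inv t i" and bi: "board_inv t u" using assms i by auto
  then have pos: "position (conf t) i = u" and uT: "u \<in> T" using rob by (auto simp: robot_inv_def)
  have W: "visits (Suc t) = insert u (visits t)"
    using pos by (simp add: i_def activate_def Let_def split: prod.splits)
  then have sub: "insert u (visits t) \<subset> T" using vis uT by auto
  obtain Vm where Vm: "Vm i = t" "informed t Vm Km"
    using ri rob by (auto simp: robot_inv_def)
  obtain Vb where Vb: "informed t Vb Kb" "\<And>c. c \<in> set X \<Longrightarrow> u @ [c] \<in> entered Vb"
    using bi brd by (auto simp: board_inv_def)
  define V where "V = (\<lambda>j. max (Vb j) (Vm j))"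
  have V: "informed t V (Kb @ Km)" unfolding V_def by (rule informed_merge[OF Vb(1) Vm(2)])
  \<comment> \<open>Clock entries never exceed \<open>t\<close>, so merging with the board keeps the
    robot's own entry.\<close>
  have Vi: "V i = t" using Vm Vb by (auto simp: V_def informed_def)
  have VX: "u @ [c] \<in> entered V" if "c \<in> set X" for c
    using Vb(2)[OF that] entered_mono[of Vb V] by (auto simp: V_def)
  note F = step_facts[OF rob ri brd bi refl sub V VX st, folded W u'_def]
  then have p: "p \<in> ports T u" by blast
  note ev = evolve[OF rob[unfolded i_def] brd pos[unfolded i_def] st p, folded i_def u'_def]
  have uT': "u' \<in> T"
    unfolding u'_def by (rule neighbour_in_tree[OF tree uT p])
  \<comment> \<open>The clock of the board already counts the place after the move, because the
    board lists the child about to be entered.\<close>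
  let ?V = "V(i := Suc t)"
  have iK': "informed (Suc t) ?V K'"
    by (rule informed_advance) (use F Vi rob ev(1) in auto)
  have "\<exists>V. V i = Suc t \<and> informed (Suc t) V K'"
    using iK' by (intro exI[of _ ?V]) simp
  then have "robot_inv (Suc t) i"
    using F uT' unfolding robot_inv_def ev(1,3) by auto
  moreover have "robot_inv (Suc t) j" if "j < k" "j \<noteq> i" for j
  proof -
    obtain uj aj Kj Ksj where rj: "robot t j = (uj, aj, Kj, Ksj)" by (metis prod_cases4)
    have rij: "robot_inv t j" using assms that by auto
    then obtain Vj where Vj: "Vj j = t" "informed t Vj Kj"
      using rj by (auto simp: robot_inv_def)
    have "informed (Suc t) (Vj(j := Suc t)) Kj"
      by (rule informed_advance) (use Vj ev(1) that in auto)
    then have "\<exists>V. V j = Suc t \<and> informed (Suc t) V Kj"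
      by (intro exI[of _ "Vj(j := Suc t)"]) simp
    moreover have "sound T (visits (Suc t)) K" if "sound T (visits t) K" for K
      using that W by (auto intro: sound_mono simp del: run.simps)
    ultimately show ?thesis
      using rij rj that unfolding robot_inv_def ev(1,3) by (auto simp del: run.simps)
  qed
  moreover have "board_inv (Suc t) v" for v
  proof (cases "v = u")
    case True
    have "entered V \<subseteq> entered ?V" using Vi by (intro entered_mono) auto
    then have *: "u @ [c] \<in> entered ?V" if "u @ [c] \<in> entered V" for c
      using that by blast
    have **: "u @ [c] \<in> entered ?V" if "place (u', a', K', Ks') = u @ [c]" for c
    proof -
      have "prefix (u @ [c]) (place (robot (Suc t) i))" using that ev(1) by simp
      then show ?thesis
        unfolding entered_def using i by (auto intro: exI[of _ i])
    qed
    have "\<forall>c\<in>set X'. u @ [c] \<in> entered ?V"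
    proof -
      have "X' = X \<or> (\<exists>c. X' = c # X \<and> place (u', a', K', Ks') = u @ [c])"
        using F by blast
      then show ?thesis
        using * ** VX by (auto simp del: place.simps)
    qed
    with iK' have "\<exists>V. informed (Suc t) V K' \<and> (\<forall>c\<in>set X'. u @ [c] \<in> entered V)"
      by blast
    then show ?thesis
      using True F bi brd unfolding board_inv_def ev(2) by (auto simp del: run.simps)
  next
    case False
    obtain Kv Xv where bv: "board t v = (Kv, Xv)" by (metis surj_pair)
    then have "\<exists>V. informed (Suc t) V Kv \<and> (\<forall>c\<in>set Xv. v @ [c] \<in> entered V)"
      using assms(2)[of v] informed_later unfolding board_inv_def by (simp del: run.simps) blast
    moreover have "sound T (visits (Suc t)) Kv"
      using assms(2)[of v] bv W by (auto simp: board_inv_def intro: sound_mono)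
    ultimately show ?thesis
      using False assms(2)[of v] bv unfolding board_inv_def ev(2) by (simp del: run.simps)
  qed
  moreover have "count_inv (Suc t)"
  proof -
    \<comment> \<open>Only the active robot and its board change, so each sum changes in one
      summand.\<close>
    have "(\<Sum>j<k. lag (robot (Suc t) j)) + lag (robot t i) =
        (\<Sum>j<k. lag (robot t j)) + lag (robot (Suc t) i)"
      using i ev(1) by (intro sum_change) auto
    moreover have "(\<Sum>j<k. cost (robot (Suc t) j)) + cost (robot t i) =
        (\<Sum>j<k. cost (robot t j)) + cost (robot (Suc t) i)"
      using i ev(1) by (intro sum_change) auto
    moreover have "(\<Sum>v\<in>T. length (snd (board (Suc t) v))) + length (snd (board t u)) =
        (\<Sum>v\<in>T. length (snd (board t v))) + length (snd (board (Suc t) u))"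
      using tree uT ev(2) by (intro sum_change) (auto simp: rooted_tree_def)
    ultimately show ?thesis
      using F rob brd assms(3) unfolding ev(1,2) count_inv_def
      by (auto simp: lag_def cost_def)
  qed
  ultimately show ?thesis using W sub by auto
qed

lemma invariants:
  assumes "\<And>\<tau>. \<tau> \<le> t \<Longrightarrow> visits \<tau> \<noteq> T"
  shows "(\<forall>i<k. robot_inv t i) \<and> (\<forall>v. board_inv t v) \<and> count_inv t \<and> visits t \<subseteq> T"
  using assms
proof (induction t)
  case 0
  have "informed 0 (\<lambda>_. 0) []"
    by (simp add: informed_def)
  then show ?case
    using tree by (auto simp: robot_inv_def board_inv_def count_inv_def robot_def board_def
        initial_config_def start_def lag_def cost_def rooted_tree_def traversal_cost_def
        intro!: exI[of _ "\<lambda>_. 0"])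
next
  case (Suc t)
  then have "visits (Suc t) \<noteq> T" by blast
  then show ?case using preserved[of t] Suc by (auto simp del: run.simps)
qed

section \<open>Bounding the number of moves\<close>

text \<open>The boards list at most the \<open>card T - 1\<close> edges, each paid twice, whence the
  summand 2. The walks of each robot are charged to the traversal of its own instance.\<close>

lemma counting:
  assumes "\<And>\<tau>. \<tau> \<le> t \<Longrightarrow> visits \<tau> \<noteq> T" and "competitive l k c" "c \<ge> 0"
  shows "real t + 2 \<le> 2 * real (card T) + real k * c * real (tree_depth T)"
proof -
  have inv: "(\<forall>i<k. robot_inv t i) \<and> (\<forall>v. board_inv t v) \<and> count_inv t"
    using invariants[of t] assms(1) by blast
  have fin: "finite T" using tree by (simp add: rooted_tree_def)
  have "length (snd (board t u)) \<le> card {c. u @ [c] \<in> T}" for u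
  proof -
    obtain K X where "board t u = (K, X)" by (metis surj_pair)
    then have X: "distinct X" "set X \<subseteq> {c. u @ [c] \<in> T}" "snd (board t u) = X"
      using inv by (auto simp: board_inv_def dest!: spec[of _ u])
    then show ?thesis
      using finite_children[OF tree] by (metis card_mono distinct_card)
  qed
  then have "(\<Sum>u\<in>T. length (snd (board t u))) \<le> (\<Sum>u\<in>T. card {c. u @ [c] \<in> T})"
    by (intro sum_mono) auto
  then have moves: "t + 2 \<le> 2 * card T + (\<Sum>i<k. cost (robot t i))"
    using inv sum_children[OF tree] by (auto simp: count_inv_def)
  have "real (cost (robot t i)) \<le> c * real (tree_depth T)" if "i < k" for i
  proof -
    obtain u a K Ks where r: "robot t i = (u, a, K, Ks)" by (metis prod_cases4)
    let ?Ls = "map layer Ks"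
    have "Ks = [] \<or> instance_ok k T ?Ls"
      using inv that r by (auto simp: robot_inv_def)
    then show ?thesis
    proof
      assume ok: "instance_ok k T ?Ls"
      then have li: "layered_instance ?Ls" and w: "instance_width ?Ls \<le> k" and "?Ls \<noteq> []"
        by (auto simp: instance_ok_def layered_instance_def instance_width_def)
      have sub: "underlying_tree ?Ls \<subseteq> T"
        using ok tree unfolding underlying_tree_def active_tree_def instance_ok_def rooted_tree_def
        by blast
      have "\<exists>x. x \<in> underlying_tree ?Ls"
        using li unfolding underlying_tree_def active_tree_def layered_instance_def
        by (cases Ks) auto
      then have "tree_depth (underlying_tree ?Ls) \<le> tree_depth T"
        unfolding tree_depth_def using sub fin by (intro Max_mono) auto
      \<comment> \<open>The instance may be shallower than \<open>T\<close>; here the sign of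
        \<open>c\<close> matters.\<close>
      then have "c * real (tree_depth (underlying_tree ?Ls)) \<le> c * real (tree_depth T)"
        using assms(3) by (intro mult_left_mono) auto
      moreover have "real (traversal_cost l ?Ls) \<le> c * real (tree_depth (underlying_tree ?Ls))"
        using assms(2) li w by (auto simp: competitive_def)
      ultimately show ?thesis by (simp add: cost_def r)
    qed (use assms(3) r in \<open>simp add: cost_def traversal_cost_def\<close>)
  qed
  then have "(\<Sum>i<k. real (cost (robot t i))) \<le> (\<Sum>i<k. c * real (tree_depth T))"
    by (intro sum_mono) auto
  then show ?thesis
    using moves by (simp add: algebra_simps flip: of_nat_sum)
qed

end

text \<open>On a one-layer instance of depth 1, \<open>c\<close> bounds a cost, which is
  nonnegative.\<close>

lemma competitive_nonneg:
  assumes "competitive l k c" "k > 0"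
  shows "c \<ge> 0"
proof -
  let ?Ls = "[{[0]}] :: node set list"
  have "layered_instance ?Ls" "instance_width ?Ls \<le> k"
    using assms(2) by (auto simp: layered_instance_def is_layer_def instance_width_def)
  moreover have "underlying_tree ?Ls = {[], [0]}"
    by (auto simp: underlying_tree_def active_tree_def prefix_Cons)
  then have "tree_depth (underlying_tree ?Ls) = 1"
    by (simp add: tree_depth_def)
  ultimately have "real (traversal_cost l ?Ls) \<le> c"
    using assms(1) by (auto simp: competitive_def)
  then show ?thesis by linarith
qed

theorem theorem5:
  fixes k :: nat and l :: "node set list \<Rightarrow> node" and c :: real
  assumes "traversal_algorithm l"
    and "lazy_traversal l"
    and "competitive l k c"
  shows "\<exists>A. dacte_algorithm A \<and>
    (\<forall>T n D. rooted_tree T \<and> card T = n \<and> tree_depth T = D \<longrightarrow>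
       explores_within A k T (2 * real n + real k * c * real D))"
proof -
  have "explores_within (explorer l) k T (2 * real (card T) + real k * c * real (tree_depth T))"
    if tree: "rooted_tree T" for T
    unfolding explores_within_def
  proof (intro allI impI)
    fix s :: "nat \<Rightarrow> nat"
    assume s: "\<forall>t. s t < k"
    interpret exploration l k T s
      using assms(1) tree s by unfold_locales auto
    let ?M = "2 * real (card T) + real k * c * real (tree_depth T)"
    have "k > 0" using s by (metis not_less_zero gr0I)
    then have c: "c \<ge> 0" using competitive_nonneg assms(3) by blast
    then have "?M \<ge> 0" by auto
    show "\<exists>t. real t \<le> ?M \<and> visited (run (explorer l) T s t) = T"
    proof (rule ccontr)
      assume none: "\<not> ?thesis"
      \<comment> \<open>If exploration were unfinished up to the integer part of \<open>?M\<close>,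
        \<open>counting\<close> would bound this integer by \<open>?M - 2\<close>.\<close>
      have "visited (run (explorer l) T s t) \<noteq> T" if "t \<le> nat \<lfloor>?M\<rfloor>" for t
        using none that \<open>?M \<ge> 0\<close>
        by (metis le_nat_iff le_floor_iff of_int_of_nat_eq zero_le_floor)
      from counting[of "nat \<lfloor>?M\<rfloor>", OF this assms(3) c] show False by linarith
    qed
  qed
  then show ?thesis
    using dacte_algorithm_explorer by blast
qed

end
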